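(* Let $S$ be an arborescent singularity, and consider a good resolution of it with dual tree $\Gamma$ and vertex set $\mathcal V$. For any three vertices $u,v,w\in\mathcal V$ such that $v\in[uw]$ (i.e. $v$ lies on the geodesic of $\Gamma$ joining $u$ and $w$), one has $$p(u,v)\cdot p(v,w)=p(v,v)\cdot p(u,w).$$ Equivalently, $$\frac{p(u,v)}{\sqrt{p(u,u)\,p(v,v)}}\cdot\frac{p(v,w)}{\sqrt{p(v,v)\,p(w,w)}}=\frac{p(u,w)}{\sqrt{p(u,u)\,p(w,w)}}.$$
   Context: A normal surface singularity $S=(S,O)$ is a germ of complex analytic normal surface (the smooth case is allowed). A resolution of $S$ is a proper bimeromorphic morphism $\pi:\tilde S\to S$ with $\tilde S$ smooth; its exceptional divisor $E=\pi^{-1}(O)$ is considered as a reduced curve, with irreducible components $(E_u)_{u\in\mathcal V}$. It is good if $E$ has simple normal crossings. The weighted dual graph $\Gamma$ of a good resolution has vertex set $\mathcal V$, as many edges between distinct $u,v$ as $E_u\cdot E_v$, and each vertex $v$ is weighted by $E_v\cdot E_v$. $S$ is arborescent if $\Gamma$ is a tree for some (equivalently, any) good resolution. The intersection matrix $(E_u\cdot E_v)_{u,v}$ is negative definite. The determinant of $\Gamma$ (or of a full subgraph) is the determinant of the matrix $(-E_u\cdot E_v)$ indexed by its vertices; it is a positive integer. For a vertex $u$ and an edge $e$ containing $u$, $\Gamma_{u,e}$ is the full subtree whose vertices are the $t\neq u$ with $e\subset[ut]$, and the edge determinant at $u$ in the direction $e$ is $\det(\Gamma_{u,e})$. For $v,w\in\mathcal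 V$, the determinant product $p(v,w)$ is the product of the edge determinants at all the vertices of the geodesic $[vw]$ in the directions of the edges not contained in $[vw]$ (an empty product equals $1$; $[vv]=\{v\}$). *)

theory Defs
  imports Complex_Main "Jordan_Normal_Form.Determinant"
begin

text \<open>
  The weighted dual graph of a good resolution is recorded by the finite set \<open>V\<close> of irreducible
  components of the exceptional divisor and by the intersection form \<open>I\<close>, with \<open>I u v\<close> the number
  $E_u \cdot E_v$: the weight of a vertex \<open>v\<close> is \<open>I v v\<close>, and two distinct vertices \<open>u\<close>, \<open>v\<close> are
  joined by \<open>I u v\<close> edges.
\<close>

definition adjacent :: "'v set \<Rightarrow> ('v \<Rightarrow> 'v \<Rightarrow> int) \<Rightarrow> 'v \<Rightarrow> 'v \<Rightarrow> bool" where
  "adjacent V I u v \<longleftrightarrow> u \<in> V \<and> v \<in> V \<and> u \<noteq> v \<and> I u v > 0"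

text \<open>
  An edge is identified with the pair of its end points; this loses nothing in a tree, where
  parallel edges do not occur.
\<close>

definition edges :: "'v set \<Rightarrow> ('v \<Rightarrow> 'v \<Rightarrow> int) \<Rightarrow> 'v set set" where
  "edges V I = {{u, v} | u v. adjacent V I u v}"

definition is_path :: "'v set \<Rightarrow> ('v \<Rightarrow> 'v \<Rightarrow> int) \<Rightarrow> 'v \<Rightarrow> 'v list \<Rightarrow> 'v \<Rightarrow> bool" where
  "is_path V I u xs v \<longleftrightarrow> xs \<noteq> [] \<and> hd xs = u \<and> last xs = v \<and> set xs \<subseteq> V \<and> distinct xs \<and>
     successively (adjacent V I) xs"

definition is_cycle :: "'v set \<Rightarrow> ('v \<Rightarrow> 'v \<Rightarrow> int) \<Rightarrow> 'v list \<Rightarrow> bool" where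
  "is_cycle V I xs \<longleftrightarrow> length xs \<ge> 3 \<and> distinct xs \<and> successively (adjacent V I) xs \<and>
     adjacent V I (last xs) (hd xs)"

text \<open>
  The first conjunct excludes the cycles of length two formed by parallel edges.  The notion of tree
  in the theory of directed graphs \<open>Graph_Theory.Digraph_Component\<close> forbids directed cycles only: an
  edge represented by two opposite arcs is already such a cycle, while an acyclic orientation hides
  the undirected ones.
\<close>

definition is_tree :: "'v set \<Rightarrow> ('v \<Rightarrow> 'v \<Rightarrow> int) \<Rightarrow> bool" where
  "is_tree V I \<longleftrightarrow>
     (\<forall>u\<in>V. \<forall>v\<in>V. u \<noteq> v \<longrightarrow> I u v \<le> 1) \<and>
     (\<forall>u\<in>V. \<forall>v\<in>V. \<exists>xs. is_path V I u xs v) \<and>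
     (\<nexists>xs. is_cycle V I xs)"

definition negative_definite :: "'v set \<Rightarrow> ('v \<Rightarrow> 'v \<Rightarrow> int) \<Rightarrow> bool" where
  "negative_definite V I \<longleftrightarrow>
     (\<forall>x :: 'v \<Rightarrow> real. (\<exists>v\<in>V. x v \<noteq> 0) \<longrightarrow>
        (\<Sum>u\<in>V. \<Sum>v\<in>V. real_of_int (I u v) * x u * x v) < 0)"

text \<open>
  The graphs below are exactly the dual trees of the good resolutions of arborescent singularities:
  the intersection matrix of a resolution is negative definite (Du Val, Mumford), and
  conversely every such weighted tree arises from a good resolution (Grauert).  The genera of the
  components play no role.
\<close>

locale arborescent_dual_graph =
  fixes V :: "'v set" and I :: "'v \<Rightarrow> 'v \<Rightarrow> int"
  assumes finite_vertices: "finite V"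
    and symmetric: "\<lbrakk>u \<in> V; v \<in> V\<rbrakk> \<Longrightarrow> I u v = I v u"
    and nonneg: "\<lbrakk>u \<in> V; v \<in> V; u \<noteq> v\<rbrakk> \<Longrightarrow> I u v \<ge> 0"
    and neg_def: "negative_definite V I"
    and tree: "is_tree V I"

text \<open>The geodesic $[uv]$, as the list of its successive vertices.\<close>

definition geodesic :: "'v set \<Rightarrow> ('v \<Rightarrow> 'v \<Rightarrow> int) \<Rightarrow> 'v \<Rightarrow> 'v \<Rightarrow> 'v list" where
  "geodesic V I u v = (THE xs. is_path V I u xs v)"

definition path_edges :: "'v list \<Rightarrow> 'v set set" where
  "path_edges xs = {{xs ! i, xs ! Suc i} | i. Suc i < length xs}"

text \<open>
  The determinant of a matrix indexed by an arbitrary finite set, by Leibniz's formula; the lemma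
  compares it with the determinant for matrices indexed by an initial segment of the
  natural numbers.
\<close>

definition det_on :: "'v set \<Rightarrow> ('v \<Rightarrow> 'v \<Rightarrow> int) \<Rightarrow> int" where
  "det_on W M = (\<Sum>\<sigma> | \<sigma> permutes W. sign \<sigma> * (\<Prod>i\<in>W. M i (\<sigma> i)))"

lemma det_on_eq_det:
  assumes f: "bij_betw f {0..<n} W"
  shows "det_on W M = det (mat n n (\<lambda>(i, j). M (f i) (f j)))"
proof -
  let ?g = "map_permutation {0..<n} f"
  have inj: "inj_on f {0..<n}" and im: "f ` {0..<n} = W"
    using f by (auto simp: bij_betw_def)
  have "det (mat n n (\<lambda>(i, j). M (f i) (f j))) =
      (\<Sum>p | p permutes {0..<n}. sign p * (\<Prod>i = 0..<n. M (f i) (f (p i))))"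
    by (subst det_def'[of _ n])
      (auto intro!: sum.cong prod.cong simp: permutes_in_image[of _ "{0..<n}", simplified])
  also have "\<dots> = (\<Sum>p | p permutes {0..<n}. sign (?g p) * (\<Prod>i\<in>W. M i (?g p i)))"
  proof (rule sum.cong[OF refl])
    fix p assume "p \<in> {p. p permutes {0..<n}}"
    then have p: "p permutes {0..<n}" by simp
    have "(\<Prod>i\<in>W. M i (?g p i)) = (\<Prod>i = 0..<n. M (f i) (?g p (f i)))"
      using prod.reindex_bij_betw[OF f, of "\<lambda>i. M i (?g p i)"] by simp
    also have "\<dots> = (\<Prod>i = 0..<n. M (f i) (f (p i)))"
      using map_permutation_apply[OF inj] by (auto intro!: prod.cong)
    finally show "sign p * (\<Prod>i = 0..<n. M (f i) (f (p i))) =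
        sign (?g p) * (\<Prod>i\<in>W. M i (?g p i))"
      using sign_map_permutation[OF inj p] by simp
  qed
  also have "\<dots> = det_on W M"
  proof -
    have "bij_betw ?g {p. p permutes {0..<n}} {p. p permutes W}"
      using bij_betw_permutations[OF f]
      by (rule iffD1[OF bij_betw_cong, rotated])
        (auto simp: map_permutation_def restrict_id_def im)
    from sum.reindex_bij_betw[OF this] show ?thesis
      unfolding det_on_def .
  qed
  finally show ?thesis by simp
qed

text \<open>The vertices of the subtree $\Gamma_{u,e}$, and the edge determinant at \<open>u\<close> towards \<open>e\<close>.\<close>

definition branch :: "'v set \<Rightarrow> ('v \<Rightarrow> 'v \<Rightarrow> int) \<Rightarrow> 'v \<Rightarrow> 'v set \<Rightarrow> 'v set" where
  "branch V I u e = {t \<in> V. t \<noteq> u \<and> e \<in> path_edges (geodesic V I u t)}"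

definition edge_det :: "'v set \<Rightarrow> ('v \<Rightarrow> 'v \<Rightarrow> int) \<Rightarrow> 'v \<Rightarrow> 'v set \<Rightarrow> int" where
  "edge_det V I u e = det_on (branch V I u e) (\<lambda>s t. - I s t)"

definition det_product :: "'v set \<Rightarrow> ('v \<Rightarrow> 'v \<Rightarrow> int) \<Rightarrow> 'v \<Rightarrow> 'v \<Rightarrow> int" where
  "det_product V I v w =
     (\<Prod>t\<in>set (geodesic V I v w).
        \<Prod>e\<in>{e \<in> edges V I. t \<in> e \<and> e \<notin> path_edges (geodesic V I v w)}. edge_det V I t e)"

end

theory Submission
  imports Defs "Jordan_Normal_Form.Char_Poly"
begin

text \<open>
  Each vertex of \<open>[uw]\<close> other than \<open>v\<close> contributes the same factor to \<open>p(u,w)\<close> and to exactly one of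
  \<open>p(u,v)\<close>, \<open>p(v,w)\<close>.  At \<open>v\<close>, the edges outside \<open>[uv]\<close> and the edges outside \<open>[vw]\<close> together make up
  all edges at \<open>v\<close>, and their common part consists of the edges outside \<open>[uw]\<close>.  The normalized
  identity follows because \<open>p(v,v)\<close> is positive, as a product of principal minors of a positive
  definite matrix.
\<close>

section \<open>Determinants of positive definite matrices\<close>

text \<open>A root \<open>k\<close> >= 0 of the characteristic polynomial of \<open>- A\<close>
  would be an eigenvalue, with an eigenvector satisfying x.Ax = -k(x.x) <= 0. The polynomial is
  monic, so it is positive far to the right and, having no root there, on the whole half-line from
  0; its value at 0 is \<open>det A\<close>.\<close>

lemma det_pos_if_positive_definite:
  fixes A :: "real mat"
  assumes A: "A \<in> carrier_mat n n"
    and pos: "\<And>x. x \<in> carrier_vec n \<Longrightarrow> x \<noteq> 0\<^sub>v n \<Longrightarrow> 0 < x \<bullet> (A *\<^sub>v x)"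
  shows "0 < det A"
proof -
  let ?p = "char_poly (- A)"
  have mA: "- A \<in> carrier_mat n n" using A by simp
  have "lead_coeff ?p = 1" using degree_monic_char_poly[OF mA] by simp
  with poly_pinfty_gt_lc[of ?p] obtain b where b: "\<And>x. x \<ge> b \<Longrightarrow> poly ?p x \<ge> 1"
    by auto
  have no_root: "poly ?p k \<noteq> 0" if "0 \<le> k" for k
  proof
    assume "poly ?p k = 0"
    then have "eigenvalue (- A) k" using eigenvalue_root_char_poly[OF mA] by simp
    then obtain x where "eigenvector (- A) x k" unfolding eigenvalue_def by blast
    then have x: "x \<in> carrier_vec n" "x \<noteq> 0\<^sub>v n" and eq: "(- A) *\<^sub>v x = k \<cdot>\<^sub>v x"
      using mA unfolding eigenvector_def by auto
    have "x \<bullet> ((- A) *\<^sub>v x) = k * (x \<bullet> x)"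
      unfolding eq using x by simp
    moreover have "x \<bullet> ((- A) *\<^sub>v x) = - (x \<bullet> (A *\<^sub>v x))"
      using A x by simp
    moreover have "0 \<le> x \<bullet> x"
      by (simp add: scalar_prod_def sum_nonneg)
    ultimately show False
      using pos[OF x] that by (smt (verit) mult_nonneg_nonneg)
  qed
  have "0 < poly ?p 0"
  proof (rule ccontr)
    assume "\<not> 0 < poly ?p 0"
    with no_root[of 0] have neg: "poly ?p 0 < 0" by simp
    \<comment> \<open>The maximum with 1 keeps the right end of the interval strictly above 0, as
      the intermediate value theorem requires.\<close>
    have "0 < poly ?p (max b 1)" using b[of "max b 1"] by simp
    with neg poly_IVT_pos[of 0 "max b 1" ?p] obtain k where "0 < k" "poly ?p k = 0"
      by (auto simp: less_max_iff_disj)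
    with no_root[of k] show False by simp
  qed
  moreover have "poly ?p 0 = det A"
  proof -
    have "- (char_matrix (- A) 0) = A"
      using A by (intro eq_matI) (auto simp: char_matrix_def)
    then show ?thesis using char_poly_matrix[OF mA, of 0] by simp
  qed
  ultimately show ?thesis by simp
qed

text \<open>Definiteness passes to principal submatrices. Enumerating \<open>W\<close> turns the
  minor into an ordinary matrix, considered over the reals, where the form is definite.\<close>

lemma det_on_pos_if_negative_definite:
  assumes "finite V" and neg: "negative_definite V I" and W: "W \<subseteq> V"
  shows "0 < det_on W (\<lambda>s t. - I s t)"
proof -
  have "finite W" using assms finite_subset by blast
  then obtain f where f: "bij_betw f {0..<card W} W"
    using ex_bij_betw_nat_finite by blast
  define n where "n = card W"
  note f = f[folded n_def]
  define A :: "int mat" where "A = mat n n (\<lambda>(i, j). - I (f i) (f j))"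
  let ?R = "map_mat real_of_int A"
  have "0 < det ?R"
  proof (rule det_pos_if_positive_definite)
    show "?R \<in> carrier_mat n n" by (simp add: A_def)
  next
    fix x :: "real vec" assume x: "x \<in> carrier_vec n" "x \<noteq> 0\<^sub>v n"
    let ?g = "the_inv_into {0..<n} f"
    \<comment> \<open>Extending \<open>x\<close> by zero outside \<open>W\<close> makes the form on
      \<open>V\<close> collapse to the sums over \<open>W\<close>.\<close>
    define y where "y v = (if v \<in> W then x $ ?g v else 0)" for v
    have y: "y (f i) = x $ i" if "i < n" for i
      using f that by (auto simp: y_def bij_betw_def the_inv_into_f_f)
    obtain i where i: "i < n" "x $ i \<noteq> 0"
      using x by (metis carrier_vecD eq_vecI index_zero_vec)
    have "f i \<in> W" using f i by (auto simp: bij_betw_def)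
    then have "\<exists>v\<in>V. y v \<noteq> 0"
      using i y W by (intro bexI[of _ "f i"]) auto
    with neg have "(\<Sum>u\<in>V. \<Sum>v\<in>V. real_of_int (I u v) * y u * y v) < 0"
      unfolding negative_definite_def by blast
    also have "(\<Sum>u\<in>V. \<Sum>v\<in>V. real_of_int (I u v) * y u * y v)
        = (\<Sum>u\<in>W. \<Sum>v\<in>V. real_of_int (I u v) * y u * y v)"
      by (rule sum.mono_neutral_right) (use assms in \<open>auto simp: y_def\<close>)
    also have "\<dots> = (\<Sum>u\<in>W. \<Sum>v\<in>W. real_of_int (I u v) * y u * y v)"
      by (intro sum.cong refl sum.mono_neutral_right) (use assms in \<open>auto simp: y_def\<close>)
    also have "\<dots> = (\<Sum>i = 0..<n. \<Sum>j = 0..<n. real_of_int (I (f i) (f j)) * x $ i * x $ j)"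
      by (simp add: sum.reindex_bij_betw[OF f, symmetric] y)
    also have "\<dots> = - (x \<bullet> (?R *\<^sub>v x))"
      using x by (auto simp: A_def scalar_prod_def sum_distrib_left sum_negf[symmetric] ac_simps
          intro!: sum.cong)
    finally show "0 < x \<bullet> (?R *\<^sub>v x)" by simp
  qed
  moreover have "det_on W (\<lambda>s t. - I s t) = det A"
    unfolding A_def by (rule det_on_eq_det[OF f])
  ultimately show ?thesis by simp
qed

section \<open>Paths and geodesics\<close>

text \<open>
  Two distinct paths with the same ends may be assumed to diverge at once; the initial part of the
  first one up to its first return to the second one then closes up to a cycle.
\<close>

lemma path_unique_if_acyclic:
  assumes sym: "\<And>a b. R a b \<Longrightarrow> R b a"
    and acyclic: "\<And>xs. \<lbrakk>length xs \<ge> 3; distinct xs; successively R xs; R (last xs) (hd xs)\<rbrakk> \<Longrightarrow> False"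
    and "xs \<noteq> []" "ys \<noteq> []" "hd xs = hd ys" "last xs = last ys"
    and "distinct xs" "distinct ys" "successively R xs" "successively R ys"
  shows "xs = ys"
  using assms(3-)
proof (induction xs arbitrary: ys)
  case Nil
  then show ?case by simp
next
  case (Cons u p)
  then obtain q where ys: "ys = u # q" by (cases ys) auto
  show ?case
  proof (cases "p = [] \<or> q = []")
    \<comment> \<open>If one tail is empty, both paths end at \<open>u\<close>, and distinctness
      empties the other tail.\<close>
    case True
    then show ?thesis using Cons.prems ys by (auto split: if_splits)
  next
    case False
    then have ne: "p \<noteq> []" "q \<noteq> []" by auto
    have last: "last p = last q" using Cons.prems ys ne by simp
    have p: "distinct p" "successively R p" "u \<notin> set p" "R u (hd p)"
      and q: "distinct q" "successively R q" "u \<notin> set q" "R u (hd q)"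
      using Cons.prems ys ne by (auto simp: successively_Cons)
    have "hd p = hd q"
    proof (rule ccontr)
      assume hd: "hd p \<noteq> hd q"
      have "\<exists>x\<in>set p. x \<in> set q" using ne last by (metis last_in_set)
      \<comment> \<open>Taking the first vertex of \<open>p\<close> on \<open>q\<close> keeps
        \<open>p1\<close> off \<open>q\<close>, which makes the closed walk \<open>?c\<close> below
        free of repetitions.\<close>
      then obtain p1 x p2 where p_eq: "p = p1 @ x # p2" and x: "x \<in> set q"
        and p1: "\<forall>y\<in>set p1. y \<notin> set q"
        by (rule split_list_first_propE)
      then obtain q1 q2 where q_eq: "q = q1 @ x # q2" by (meson split_list)
      let ?c = "u # p1 @ x # rev q1"
      \<comment> \<open>Otherwise both tails would start at \<open>x\<close>; hence a third vertex
        besides \<open>u\<close> and \<open>x\<close>.\<close>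
      have "p1 \<noteq> [] \<or> q1 \<noteq> []" using hd p_eq q_eq by auto
      then have "length ?c \<ge> 3" by (cases p1; cases q1) auto
      moreover have "distinct ?c" using p q p1 p_eq q_eq by auto
      moreover have "successively R ?c"
      proof -
        have "successively R (q1 @ [x])"
          using q(2) unfolding q_eq by (auto simp: successively_append_iff)
        then have "successively R (rev (q1 @ [x]))"
          unfolding successively_rev by (rule successively_mono) (auto intro: sym)
        then show ?thesis
          using p unfolding p_eq
          by (cases p1) (auto simp: successively_Cons successively_append_iff hd_append)
      qed
      moreover have "R (last ?c) (hd ?c)"
        using q(4) sym unfolding q_eq by (cases q1) auto
      ultimately show False by (rule acyclic)
    qed
    then show ?thesis using Cons.IH[of q] ne last p q ys by simp
  qed
qed

lemma path_edges_Nil [simp]: "path_edges [] = {}"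
  and path_edges_single [simp]: "path_edges [x] = {}"
  by (auto simp: path_edges_def)

lemma path_edges_Cons_Cons [simp]:
  "path_edges (x # y # zs) = insert {x, y} (path_edges (y # zs))"
proof -
  have "{i. Suc i < length (x # y # zs)} = insert 0 (Suc ` {i. Suc i < length (y # zs)})"
    by (auto simp: image_iff less_Suc_eq_0_disj)
  moreover have "path_edges xs = (\<lambda>i. {xs ! i, xs ! Suc i}) ` {i. Suc i < length xs}"
    for xs :: "'a list"
    by (auto simp: path_edges_def)
  ultimately show ?thesis by (simp add: image_image)
qed

text \<open>The cut vertex is kept in both pieces, so the edge entering \<open>v\<close> is not
  lost.\<close>

lemma path_edges_append:
  "path_edges (ys @ v # zs) = path_edges (ys @ [v]) \<union> path_edges (v # zs)"
proof (induction ys)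
  case (Cons y ys)
  then show ?case by (cases ys) auto
qed simp

lemma path_edges_subset: "e \<in> path_edges xs \<Longrightarrow> e \<subseteq> set xs"
  by (auto simp: path_edges_def)

context arborescent_dual_graph
begin

lemma geodesic_eqI:
  assumes "is_path V I u xs v"
  shows "geodesic V I u v = xs"
  unfolding geodesic_def
proof (rule the_equality)
  show "is_path V I u xs v" by fact
next
  fix ys assume ys: "is_path V I u ys v"
  show "ys = xs"
  proof (rule path_unique_if_acyclic[of "adjacent V I"])
    show "adjacent V I b a" if "adjacent V I a b" for a b
      using that symmetric by (auto simp: adjacent_def)
    show False if "length zs \<ge> 3" "distinct zs" "successively (adjacent V I) zs"
        "adjacent V I (last zs) (hd zs)" for zs
      using that tree unfolding is_tree_def is_cycle_def by blast
  qed (use ys assms in \<open>auto simp: is_path_def\<close>)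
qed

lemma is_path_geodesic:
  assumes "u \<in> V" "v \<in> V"
  shows "is_path V I u (geodesic V I u v) v"
proof -
  obtain xs where "is_path V I u xs v"
    using tree assms unfolding is_tree_def by blast
  then show ?thesis using geodesic_eqI by metis
qed

text \<open>Both pieces of a path cut at \<open>v\<close> are again paths, hence geodesics by
  uniqueness.\<close>

lemma geodesic_split:
  assumes "u \<in> V" "w \<in> V" "v \<in> set (geodesic V I u w)"
  obtains ys zs where "geodesic V I u w = ys @ v # zs" "distinct (ys @ v # zs)"
    "geodesic V I u v = ys @ [v]" "geodesic V I v w = v # zs" "geodesic V I v v = [v]"
proof -
  obtain ys zs where split: "geodesic V I u w = ys @ v # zs"
    using assms(3) by (meson split_list)
  with is_path_geodesic[OF assms(1,2)] have path: "is_path V I u (ys @ v # zs) w" by simp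
  from path have "successively (adjacent V I) (ys @ [v])"
    by (auto simp: is_path_def successively_append_iff)
  with path have "is_path V I u (ys @ [v]) v"
    by (auto simp: is_path_def hd_append)
  moreover from path have "is_path V I v (v # zs) w"
    by (auto simp: is_path_def successively_append_iff)
  moreover from path have "is_path V I v [v] v"
    by (auto simp: is_path_def)
  moreover from path have "distinct (ys @ v # zs)" by (simp add: is_path_def)
  ultimately show ?thesis using that split geodesic_eqI by blast
qed

section \<open>Positivity and multiplicativity of determinant products\<close>

lemma finite_edges: "finite (edges V I)"
  by (rule finite_subset[of _ "Pow V"]) (auto simp: edges_def adjacent_def finite_vertices)

lemma edge_det_pos: "0 < edge_det V I u e"
  unfolding edge_det_def
  by (rule det_on_pos_if_negative_definite[OF finite_vertices neg_def]) (auto simp: branch_def)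

lemma det_product_pos: "0 < det_product V I v w"
  unfolding det_product_def by (intro prod_pos edge_det_pos)

lemma det_product_mult:
  assumes "u \<in> V" "w \<in> V" "v \<in> set (geodesic V I u w)"
  shows "det_product V I u v * det_product V I v w = det_product V I v v * det_product V I u w"
proof -
  from assms obtain ys zs where g: "geodesic V I u w = ys @ v # zs"
      "geodesic V I u v = ys @ [v]" "geodesic V I v w = v # zs" "geodesic V I v v = [v]"
    and dist: "distinct (ys @ v # zs)"
    by (rule geodesic_split)
  define A where "A = path_edges (ys @ [v])"
  define B where "B = path_edges (v # zs)"
  \<comment> \<open>\<open>F X t\<close> is the factor contributed by the vertex \<open>t\<close> of
    a geodesic whose edge set is \<open>X\<close>.\<close>
  define N where "N X t = {e \<in> edges V I. t \<in> e \<and> e \<notin> X}" for X t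
  define F where "F X t = (\<Prod>e\<in>N X t. edge_det V I t e)" for X t
  have AB: "path_edges (ys @ v # zs) = A \<union> B"
    unfolding A_def B_def by (rule path_edges_append)
  have p: "det_product V I a b = prod (F (path_edges (geodesic V I a b))) (set (geodesic V I a b))"
    for a b
    by (simp add: det_product_def F_def N_def)
  have uv: "det_product V I u v = prod (F A) (set ys) * F A v"
    unfolding p g A_def[symmetric] using dist by (simp add: mult.commute)
  have vw: "det_product V I v w = F B v * prod (F B) (set zs)"
    unfolding p g B_def[symmetric] using dist by simp
  have vv: "det_product V I v v = F {} v"
    unfolding p g by simp
  have uw: "det_product V I u w = prod (F (A \<union> B)) (set ys) * F (A \<union> B) v * prod (F (A \<union> B)) (set zs)"
    unfolding p g AB using dist by (simp add: prod.union_disjoint mult.assoc)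
  have ys: "prod (F (A \<union> B)) (set ys) = prod (F A) (set ys)"
  proof (rule prod.cong[OF refl])
    fix t assume "t \<in> set ys"
    \<comment> \<open>Edges of [vw] have their ends in \<open>v # zs\<close>, which misses
      \<open>ys\<close>, so excluding them changes nothing at \<open>t\<close>.\<close>
    then have "t \<notin> e" if "e \<in> B" for e
      using path_edges_subset[of e "v # zs"] that dist by (auto simp: B_def)
    then have "N (A \<union> B) t = N A t" by (auto simp: N_def)
    then show "F (A \<union> B) t = F A t" by (simp add: F_def)
  qed
  have zs: "prod (F (A \<union> B)) (set zs) = prod (F B) (set zs)"
  proof (rule prod.cong[OF refl])
    fix t assume "t \<in> set zs"
    then have "t \<notin> e" if "e \<in> A" for e
      using path_edges_subset[of e "ys @ [v]"] that dist by (auto simp: A_def)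
    then have "N (A \<union> B) t = N B t" by (auto simp: N_def)
    then show "F (A \<union> B) t = F B t" by (simp add: F_def)
  qed
  have v: "F A v * F B v = F {} v * F (A \<union> B) v"
  proof -
    \<comment> \<open>A common edge would have both ends equal to \<open>v\<close>.\<close>
    have "e \<notin> A \<inter> B" if "e \<in> edges V I" for e
    proof
      assume "e \<in> A \<inter> B"
      then have "e \<subseteq> set (ys @ [v]) \<inter> set (v # zs)"
        unfolding A_def B_def using path_edges_subset by blast
      also have "\<dots> = {v}" using dist by auto
      finally show False using that by (auto simp: edges_def adjacent_def)
    qed
    \<comment> \<open>As no edge lies in both parts, every edge at \<open>v\<close> avoids one of
      them; inclusion-exclusion for products then applies.\<close>
    then have "N A v \<union> N B v = N {} v" "N A v \<inter> N B v = N (A \<union> B) v"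
      by (auto simp: N_def)
    moreover have "finite (N X v)" for X using finite_edges by (simp add: N_def)
    ultimately show ?thesis
      unfolding F_def using prod.union_inter[of "N A v" "N B v" "edge_det V I v"] by simp
  qed
  show ?thesis
    unfolding uv vw vv uw ys zs using v by (simp add: algebra_simps)
qed

end

theorem proposition69:
  fixes V :: "'v set" and I :: "'v \<Rightarrow> 'v \<Rightarrow> int" and u v w :: 'v
  assumes "arborescent_dual_graph V I"
    and "u \<in> V" and "v \<in> V" and "w \<in> V"
    and "v \<in> set (geodesic V I u w)"
  shows "det_product V I u v * det_product V I v w = det_product V I v v * det_product V I u w
       \<and> real_of_int (det_product V I u v)
           / sqrt (real_of_int (det_product V I u u) * real_of_int (det_product V I v v))
         * (real_of_int (det_product V I v w)
           / sqrt (real_of_int (det_product V I v v) * real_of_int (det_product V I w w)))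
         = real_of_int (det_product V I u w)
           / sqrt (real_of_int (det_product V I u u) * real_of_int (det_product V I w w))"
proof -
  interpret arborescent_dual_graph V I by fact
  let ?p = "\<lambda>a b. real_of_int (det_product V I a b)"
  have eq: "det_product V I u v * det_product V I v w = det_product V I v v * det_product V I u w"
    using assms by (intro det_product_mult)
  then have "?p u v * ?p v w = ?p v v * ?p u w"
    by (metis of_int_mult)
  moreover have pos: "0 < ?p v v"
    by (simp add: det_product_pos)
  \<comment> \<open>The two roots of p(v,v) multiply to p(v,v), which cancels the factor p(v,v) of
    the integer identity.\<close>
  moreover have "sqrt (?p u u * ?p v v) * sqrt (?p v v * ?p w w) = ?p v v * sqrt (?p u u * ?p w w)"
    using pos by (simp add: real_sqrt_mult)
  ultimately have "?p u v / sqrt (?p u u * ?p v v) * (?p v w / sqrt (?p v v * ?p w w))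
      = ?p u w / sqrt (?p u u * ?p w w)"
    by simp
  with eq show ?thesis by blast
qed

end
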